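(* Let $b>1$ be an integer, let $M_{1,b}$ be the regular arithmetical congruence monoid with modulus $b$, and let $x\in M_{1,b}$ with $x\neq 1$. If $x=\prod_{i=1}^{n}p_i^{e_i}$ is the prime factorization of $x$ in $\mathbb{Z}$ (with $p_1,\dots,p_n$ distinct primes and $e_i\ge 1$), then $\omega(x)=\sum_{i=1}^{n}e_i$.
   Context: For integers $0<a\le b$ with $a^2\equiv a \pmod b$, the arithmetical congruence monoid (ACM) is $M_{a,b}=\{a+bk : k\in\mathbb{N}_0\}\cup\{1\}$ under multiplication; its only unit is $1$. It is called regular if $a=1$, so $M_{1,b}=1+b\mathbb{N}_0$. For $x,y$ in a commutative cancellative monoid $M$, $x\mid_M y$ means $y=xz$ for some $z\in M$. For a nonunit $x\in M$, the omega primality $\omega(x)=\omega_M(x)$ is the smallest positive integer $m$ such that whenever $k>m$ and $a_1,\dots,a_k\in M$ satisfy $x\mid_M \prod_{i=1}^k a_i$, there is a proper subset $S\subsetneq\{1,\dots,k\}$ with $x\mid_M\prod_{i\in S}a_i$; if no such $m$ exists, $\omega(x)=\infty$. *)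

theory Defs
  imports
    "HOL-Library.Extended_Nat"
    "HOL-Number_Theory.Cong"
    "HOL-Computational_Algebra.Primes"
    "HOL-Algebra.FiniteProduct"
    "HOL-Algebra.Divisibility"
begin

definition acm :: "nat \<Rightarrow> nat \<Rightarrow> nat monoid" where
  "acm a b = \<lparr>carrier = {a + b * k | k. True} \<union> {1}, mult = (*), one = 1\<rparr>"

lemma comm_monoid_cancel_acm:
  assumes "0 < a" "a \<le> b" "[a\<^sup>2 = a] (mod b)"
  shows "comm_monoid_cancel (acm a b)"
proof -
  have pos: "x > 0" if "x \<in> carrier (acm a b)" for x
    using that assms by (auto simp: acm_def)
  have closed: "x * y \<in> carrier (acm a b)"
    if xy: "x \<in> carrier (acm a b)" "y \<in> carrier (acm a b)" for x y
  proof -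
    consider "x = 1" | "y = 1" | k l where "x = a + b * k" "y = a + b * l"
      using xy by (auto simp: acm_def)
    then show ?thesis
    proof cases
      case 3
      have "a \<le> a\<^sup>2" using assms by (simp add: power2_eq_square)
      then obtain m where "a\<^sup>2 = m * b + a"
        using cong_le_nat[of a "a\<^sup>2" b] assms(3) by blast
      then have "x * y = a + b * (m + a * k + a * l + b * k * l)"
        using 3 by (simp add: algebra_simps power2_eq_square)
      then show ?thesis unfolding acm_def by auto
    qed (use xy in auto)
  qed
  show ?thesis
  proof (rule comm_monoid_cancelI)
    show "comm_monoid (acm a b)"
      by (rule comm_monoidI) (use closed in \<open>auto simp: acm_def\<close>)
    show "x = y" if "x \<otimes>\<^bsub>acm a b\<^esub> z = y \<otimes>\<^bsub>acm a b\<^esub> z"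
      "x \<in> carrier (acm a b)" "y \<in> carrier (acm a b)" "z \<in> carrier (acm a b)" for x y z
      using that(1) pos[OF that(4)] by (simp add: acm_def)
  qed
qed

definition omega_bound :: "('a, 'c) monoid_scheme \<Rightarrow> 'a \<Rightarrow> nat \<Rightarrow> bool" where
  "omega_bound M x m \<longleftrightarrow>
     (\<forall>k>m. \<forall>a \<in> {1..k} \<rightarrow> carrier M.
        x divides\<^bsub>M\<^esub> (\<Otimes>\<^bsub>M\<^esub>i\<in>{1..k}. a i) \<longrightarrow>
        (\<exists>S. S \<subset> {1..k} \<and> x divides\<^bsub>M\<^esub> (\<Otimes>\<^bsub>M\<^esub>i\<in>S. a i)))"

text \<open>Meaningful for a nonunit \<open>x\<close> of a commutative cancellative monoid \<open>M\<close>.\<close>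

definition omega :: "('a, 'c) monoid_scheme \<Rightarrow> 'a \<Rightarrow> enat" where
  "omega M x =
     (if \<exists>m>0. omega_bound M x m then enat (LEAST m. m > 0 \<and> omega_bound M x m) else \<infinity>)"

end

(* Divisibility in a regular ACM agrees with divisibility in the integers. Hence, if x divides a
   product, one factor per prime of x (counted with multiplicity) already suffices. The bound is
   attained by giving each prime p of x its own factor p * c, where c is coprime to x and
   p * c = 1 modulo b: no factor can then be left out. *)
theory Submission
  imports Defs
begin

declare One_nat_def [simp del]

lemma carrier_acm_1_iff: "x \<in> carrier (acm 1 b) \<longleftrightarrow> x > 0 \<and> [x = 1] (mod b)"
proof
  assume "x > 0 \<and> [x = 1] (mod b)"
  then obtain k where "x = k * b + 1"
    using cong_le_nat[of 1 x b] by auto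
  then show "x \<in> carrier (acm 1 b)"
    by (auto simp: acm_def mult.commute)
next
  assume "x \<in> carrier (acm 1 b)"
  then obtain k where "x = 1 + b * k \<or> x = 1" by (auto simp: acm_def)
  then show "x > 0 \<and> [x = 1] (mod b)"
    unfolding cong_def by (metis add_gr_0 mod_mult_self2 zero_less_one)
qed

text \<open>This is where regularity enters: since \<open>x\<close> is 1 modulo \<open>b\<close>, a
  quotient \<open>z\<close> with \<open>y = x * z\<close> satisfies \<open>z = y = 1\<close> modulo
  \<open>b\<close>, so it lies in the monoid by itself.\<close>

lemma acm_1_divides_iff:
  assumes x: "x \<in> carrier (acm 1 b)" and y: "y \<in> carrier (acm 1 b)"
  shows "x divides\<^bsub>acm 1 b\<^esub> y \<longleftrightarrow> x dvd y"
proof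
  assume "x dvd y"
  then obtain z where z: "y = x * z" ..
  have "[x * z = 1 * z] (mod b)"
    using x by (intro cong_scalar_right) (simp add: carrier_acm_1_iff)
  then have "[z = 1] (mod b)"
    using y z by (metis carrier_acm_1_iff cong_sym cong_trans mult_1)
  moreover have "z > 0"
    using y z by (simp add: carrier_acm_1_iff)
  ultimately have "z \<in> carrier (acm 1 b)"
    by (simp add: carrier_acm_1_iff)
  then show "x divides\<^bsub>acm 1 b\<^esub> y"
    using z by (auto simp: factor_def acm_def)
qed (auto simp: factor_def acm_def)

text \<open>Translates the monoid products of \<open>omega_bound\<close> into ordinary ones;
  membership of the product is what allows \<open>acm_1_divides_iff\<close> to be applied to
  it.\<close>

lemma acm_1_finprod:
  assumes "b > 0" and "finite S" and "a \<in> S \<rightarrow> carrier (acm 1 b)"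
  shows "(\<Otimes>\<^bsub>acm 1 b\<^esub>i\<in>S. a i) = (\<Prod>i\<in>S. a i) \<and> (\<Prod>i\<in>S. a i) \<in> carrier (acm 1 b)"
proof -
  interpret comm_monoid_cancel "acm 1 b"
    using assms(1) by (intro comm_monoid_cancel_acm) auto
  have "(\<Otimes>\<^bsub>acm 1 b\<^esub>i\<in>S. a i) = (\<Prod>i\<in>S. a i)"
    using assms(2,3)
  proof (induction S)
    case empty
    show ?case unfolding finprod_empty by (simp add: acm_def)
  next
    case (insert i S)
    then have "(\<Otimes>\<^bsub>acm 1 b\<^esub>j\<in>insert i S. a j) = a i \<otimes>\<^bsub>acm 1 b\<^esub> (\<Otimes>\<^bsub>acm 1 b\<^esub>j\<in>S. a j)"
      by (intro finprod_insert) auto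
    then show ?case
      using insert by (simp add: acm_def Pi_iff)
  qed
  then show ?thesis
    using finprod_closed[of a S] assms(3) by auto
qed

text \<open>Each prime of \<open>P\<close> divides some factor; it is stripped from that factor and
  the induction continues with the rest. One index may serve several primes, hence only an upper
  bound on \<open>card S\<close>.\<close>

lemma prod_mset_primes_dvd_prod_subset:
  fixes a :: "'i \<Rightarrow> 'a :: factorial_semiring"
  assumes "finite A" and "\<And>p. p \<in># P \<Longrightarrow> Factorial_Ring.prime p"
    and "prod_mset P dvd prod a A"
  shows "\<exists>S\<subseteq>A. card S \<le> size P \<and> prod_mset P dvd prod a S"
  using assms(2,3)
proof (induction P arbitrary: a)
  case empty
  then show ?case by (intro exI[of _ "{}"]) auto
next
  case (add p P)
  have p: "Factorial_Ring.prime p" using add.prems by auto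
  have "p dvd prod a A" using add.prems(2) by (auto intro: dvd_mult_left)
  then obtain j where j: "j \<in> A" "p dvd a j"
    using p prime_dvd_prod_iff[OF assms(1) p] by blast
  then obtain c where c: "a j = p * c" by blast
  define a' where "a' = a(j := c)"
  \<comment> \<open>Replacing \<open>a j\<close> by its cofactor \<open>c\<close> removes exactly
    one \<open>p\<close> from any product that includes the index \<open>j\<close>.\<close>
  have split: "prod a T = p * prod a' T" if "j \<in> T" "finite T" for T
  proof -
    have "prod a (T - {j}) = prod a' (T - {j})"
      by (rule prod.cong) (auto simp: a'_def)
    then show ?thesis
      using that c by (simp add: prod.remove[of T j] a'_def mult.assoc)
  qed
  have "prod_mset P dvd prod a' A"
    using add.prems(2) split[OF j(1) assms(1)] p by auto
  then obtain S where S: "S \<subseteq> A" "card S \<le> size P" "prod_mset P dvd prod a' S"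
    using add.IH add.prems(1) by (metis union_single_eq_member add_mset_add_single union_iff)
  have fin: "finite S" using S(1) assms(1) finite_subset by blast
  \<comment> \<open>The set from the induction may miss \<open>j\<close>; adding \<open>j\<close>
    preserves divisibility and makes \<open>split\<close> applicable.\<close>
  have "prod a' S dvd prod a' (insert j S)"
    using fin by (intro prod_dvd_prod_subset) auto
  then have "prod_mset P dvd prod a' (insert j S)"
    using S(3) dvd_trans by blast
  then have "prod_mset (add_mset p P) dvd prod a (insert j S)"
    using split[of "insert j S"] fin by (simp add: mult_dvd_mono)
  moreover have "card (insert j S) \<le> size (add_mset p P)"
    using S(2) by (simp add: card_insert_if fin)
  ultimately show ?case
    using S(1) j(1) by blast
qed

text \<open>By the Chinese remainder theorem, \<open>c\<close> can be an inverse of \<open>p\<close>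
  modulo \<open>b\<close> and 1 modulo \<open>x\<close> at once.\<close>

lemma cong_one_multiple_coprime:
  fixes b p x :: nat
  assumes "coprime p b" and "coprime x b"
  shows "\<exists>c. [p * c = 1] (mod b) \<and> coprime c x"
proof -
  obtain u where u: "[p * u = 1] (mod b)"
    using cong_solve_coprime_nat[OF assms(1)] by (auto simp: One_nat_def)
  obtain c where c: "[c = u] (mod b)" "[c = 1] (mod x)"
    using binary_chinese_remainder_nat[of b x u 1] assms(2) by (auto simp: coprime_commute)
  have "[p * c = 1] (mod b)"
    using cong_scalar_left[OF c(1), of p] u cong_trans by blast
  moreover have "coprime c x"
    using c(2) cong_imp_coprime cong_sym coprime_1_left by blast
  ultimately show ?thesis by blast
qed

text \<open>Supplies the lower bound for omega: the multipliers \<open>c i\<close> bring the primes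
  into the monoid but, being coprime to \<open>x\<close>, cannot replace a missing prime.\<close>

lemma acm_1_minimal_product:
  assumes "b > 0" and "prod_mset P \<in> carrier (acm 1 b)"
    and "\<And>p. p \<in># P \<Longrightarrow> Factorial_Ring.prime p"
  shows "\<exists>a \<in> {1..size P} \<rightarrow> carrier (acm 1 b). prod_mset P dvd prod a {1..size P} \<and>
           (\<forall>S. S \<subset> {1..size P} \<longrightarrow> \<not> prod_mset P dvd prod a S)"
proof -
  let ?x = "prod_mset P" and ?I = "{1..size P}"
  obtain ps where ps: "mset ps = P" using ex_mset by blast
  \<comment> \<open>The list is indexed from 0, the factors from 1.\<close>
  define q where "q i = ps ! (i - 1)" for i
  have len: "length ps = size P" using ps by auto
  have q_prime: "Factorial_Ring.prime (q i)" if "i \<in> ?I" for i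
  proof -
    have "i - 1 < length ps" using that len by auto
    then have "q i \<in> set ps" unfolding q_def by (rule nth_mem)
    then show ?thesis using assms(3) ps by auto
  qed
  have "prod q ?I = prod (\<lambda>i. ps ! i) {..<length ps}"
    by (rule prod.reindex_bij_witness[of _ Suc "\<lambda>i. i - 1"]) (auto simp: q_def len)
  also have "\<dots> = ?x"
    unfolding ps[symmetric] prod_mset_prod_list by (simp add: prod.list_conv_set_nth atLeast0LessThan)
  finally have q_prod: "prod q ?I = ?x" .
  have q_dvd: "q i dvd ?x" if "i \<in> ?I" for i
    unfolding q_prod[symmetric] using that by (intro dvd_prodI) auto
  have x_pos: "?x > 0" and x_cong: "[?x = 1] (mod b)"
    using assms(2) by (auto simp: carrier_acm_1_iff)
  \<comment> \<open>Passes to every prime divisor \<open>q i\<close>, which is therefore invertible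
    modulo \<open>b\<close>.\<close>
  have x_coprime: "coprime ?x b"
    using cong_imp_coprime[OF cong_sym[OF x_cong]] by simp
  have "\<exists>c. [q i * c = 1] (mod b) \<and> coprime c ?x" if "i \<in> ?I" for i
    using coprime_divisors[OF q_dvd[OF that] dvd_refl x_coprime] x_coprime
    by (rule cong_one_multiple_coprime)
  then obtain c where c: "\<And>i. i \<in> ?I \<Longrightarrow> [q i * c i = 1] (mod b)"
    and c_coprime: "\<And>i. i \<in> ?I \<Longrightarrow> coprime (c i) ?x"
    by metis
  define a where "a i = q i * c i" for i
  have a: "a i \<in> carrier (acm 1 b)" if i: "i \<in> ?I" for i
  proof -
    \<comment> \<open>Rules out \<open>c i = 0\<close>, since 0 is coprime only to units.\<close>
    have "?x \<noteq> 1" using q_dvd[OF i] q_prime[OF i] not_prime_unit by metis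
    then have "c i > 0" using c_coprime[OF i] by (cases "c i = 0") auto
    then show ?thesis
      using c[OF i] prime_gt_0_nat[OF q_prime[OF i]] by (simp add: a_def carrier_acm_1_iff)
  qed
  have a_prod: "prod a S = prod q S * prod c S" for S
    unfolding a_def by (rule prod.distrib)
  have "\<not> ?x dvd prod a S" if S: "S \<subset> ?I" for S
  proof
    assume "?x dvd prod a S"
    moreover have "coprime ?x (prod c S)"
      using c_coprime S by (intro prod_coprime_right) (auto simp: coprime_commute)
    ultimately have dvd: "?x dvd prod q S"
      unfolding a_prod by (simp add: coprime_dvd_mult_left_iff)
    \<comment> \<open>Cancelling \<open>prod q S\<close> makes the product of the omitted primes a
      unit, although \<open>S\<close> omits at least one prime.\<close>
    have x_split: "?x = prod q S * prod q (?I - S)"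
      using prod.subset_diff[of S ?I q] S unfolding q_prod by (simp add: mult.commute psubset_imp_subset)
    then have "prod q S > 0" using x_pos by (metis mult_0 neq0_conv)
    moreover have "prod q S * prod q (?I - S) dvd prod q S * 1"
      using dvd x_split by simp
    ultimately have unit: "is_unit (prod q (?I - S))"
      by (simp only: nat_mult_dvd_cancel1)
    obtain i where i: "i \<in> ?I - S" using S by blast
    then have "q i dvd prod q (?I - S)" by (intro dvd_prodI) auto
    then have "is_unit (q i)" using unit dvd_trans by blast
    then show False
      using q_prime[of i] i not_prime_unit by blast
  qed
  moreover have "?x dvd prod a ?I"
    unfolding a_prod q_prod by simp
  ultimately show ?thesis using a by (intro bexI[of _ a]) auto
qed

text \<open>Nonemptiness of \<open>P\<close> makes \<open>size P\<close> positive, so it is an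
  admissible value in the definition of \<open>omega\<close>.\<close>

lemma omega_acm_1_prod_mset_primes:
  assumes b: "b > 0" and x: "prod_mset P \<in> carrier (acm 1 b)" and "P \<noteq> {#}"
    and P: "\<And>p. p \<in># P \<Longrightarrow> Factorial_Ring.prime p"
  shows "omega (acm 1 b) (prod_mset P) = enat (size P)"
proof -
  let ?x = "prod_mset P"
  have div_iff: "?x divides\<^bsub>acm 1 b\<^esub> (\<Otimes>\<^bsub>acm 1 b\<^esub>i\<in>S. a i) \<longleftrightarrow> ?x dvd prod a S"
    if "a \<in> {1..k} \<rightarrow> carrier (acm 1 b)" "S \<subseteq> {1..k}" for S a and k :: nat
  proof -
    have "a \<in> S \<rightarrow> carrier (acm 1 b)" "finite S"
      using that finite_subset by auto
    then show ?thesis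
      using acm_1_finprod[OF b] acm_1_divides_iff[OF x] by metis
  qed
  have upper: "omega_bound (acm 1 b) ?x (size P)"
    unfolding omega_bound_def
  proof (intro allI ballI impI)
    fix k a
    assume k: "k > size P" and a: "a \<in> {1..k} \<rightarrow> carrier (acm 1 b)"
      and "?x divides\<^bsub>acm 1 b\<^esub> (\<Otimes>\<^bsub>acm 1 b\<^esub>i\<in>{1..k}. a i)"
    then have "?x dvd prod a {1..k}" using div_iff by blast
    then obtain S where S: "S \<subseteq> {1..k}" "card S \<le> size P" "?x dvd prod a S"
      using prod_mset_primes_dvd_prod_subset[of "{1..k}" P a] P by auto
    \<comment> \<open>Properness by counting: \<open>card S\<close> is at most
      \<open>size P\<close>, which is below \<open>k\<close>.\<close>
    then have "S \<subset> {1..k}" using k by auto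
    then show "\<exists>S. S \<subset> {1..k} \<and> ?x divides\<^bsub>acm 1 b\<^esub> (\<Otimes>\<^bsub>acm 1 b\<^esub>i\<in>S. a i)"
      using S div_iff[OF a S(1)] by blast
  qed
  have lower: "size P \<le> m" if m: "omega_bound (acm 1 b) ?x m" for m
  proof (rule ccontr)
    assume "\<not> size P \<le> m"
    then have "size P > m" by simp
    \<comment> \<open>If \<open>m\<close> were smaller, \<open>omega_bound\<close> could be applied
      with \<open>k = size P\<close> to these factors.\<close>
    moreover obtain a where a: "a \<in> {1..size P} \<rightarrow> carrier (acm 1 b)"
      and "?x dvd prod a {1..size P}"
      and "\<And>S. S \<subset> {1..size P} \<Longrightarrow> \<not> ?x dvd prod a S"
      using acm_1_minimal_product[OF b x P] by blast
    ultimately show False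
      using m div_iff[OF a] unfolding omega_bound_def by (meson order_refl psubset_imp_subset)
  qed
  have "size P > 0" using \<open>P \<noteq> {#}\<close> by (simp add: nonempty_has_size)
  moreover from this have "(LEAST m. m > 0 \<and> omega_bound (acm 1 b) ?x m) = size P"
    using upper lower by (intro Least_equality) auto
  ultimately show ?thesis
    using upper by (auto simp: omega_def)
qed

theorem proposition3p1:
  fixes b x n :: nat and p e :: "nat \<Rightarrow> nat"
  assumes "b > 1"
    and "x \<in> carrier (acm 1 b)" and "x \<noteq> 1"
    and "\<And>i. i \<in> {1..n} \<Longrightarrow> Factorial_Ring.prime (p i)"
    and "inj_on p {1..n}"
    and "\<And>i. i \<in> {1..n} \<Longrightarrow> e i \<ge> 1"
    and "x = (\<Prod>i=1..n. p i ^ e i)"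
  shows "omega (acm 1 b) x = enat (\<Sum>i=1..n. e i)"
proof -
  \<comment> \<open>The multiset of prime factors with multiplicity: its product is \<open>x\<close>
    and its size the sum of the exponents.\<close>
  define P where "P = (\<Sum>i=1..n. replicate_mset (e i) (p i))"
  have prod: "prod_mset P = x"
    unfolding P_def assms(7) by (induction n) auto
  have size: "size P = (\<Sum>i=1..n. e i)"
    unfolding P_def by (simp add: size_multiset_sum)
  have "Factorial_Ring.prime q" if "q \<in># P" for q
    using that assms(4) unfolding P_def by (auto simp: set_mset_sum split: if_splits)
  moreover have "P \<noteq> {#}" using prod assms(3) by auto
  ultimately show ?thesis
    using omega_acm_1_prod_mset_primes[of b P] assms(1,2) prod size by simp
qed

end
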